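(* Let $X=\mathbb{R}^d$ with the Euclidean norm, let $F$ be the Euclidean closed unit ball of $X$, let $\Omega_1,\ldots,\Omega_n\subset X$ ($n\ge 1$) be nonempty closed bounded sets, and let $\Omega\subset X$ be a nonempty closed convex set. Then the optimization problem $$\text{minimize } C(x)=\max\{C_F(x;\Omega_i): i=1,\ldots,n\}\quad\text{subject to } x\in\Omega$$ has a unique solution.
   Context: For a nonempty bounded set $Q\subset X$ and $x\in X$, the maximal time function is $C_F(x;Q)=\inf\{t\ge 0: Q\subset x+tF\}$. A solution of the optimization problem is a point $\bar x\in\Omega$ with $C(\bar x)\le C(x)$ for all $x\in\Omega$. *)

theory Defs
  imports "HOL-Analysis.Analysis"
begin

(* C_F(x;Q).  The infimum is taken in the reals.  It is the intended value whenever some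
   dilate x + t F with t >= 0 contains Q, as is the case for bounded Q when 0 is an interior
   point of F; otherwise Inf {} is an unspecified real. *)
definition max_time ::
  "'a::real_vector set \<Rightarrow> 'a \<Rightarrow> 'a set \<Rightarrow> real" where
  "max_time F x Q = Inf {t. t \<ge> 0 \<and> Q \<subseteq> (\<lambda>f. x + t *\<^sub>R f) ` F}"

(* The targets are indexed by 1, ..., n; only n >= 1 is meaningful, as Max {} is unspecified. *)
definition max_time_cost ::
  "'a::real_vector set \<Rightarrow> nat \<Rightarrow> (nat \<Rightarrow> 'a set) \<Rightarrow> 'a \<Rightarrow> real" where
  "max_time_cost F n Q x = Max ((\<lambda>i. max_time F x (Q i)) ` {1..n})"

definition solution :: "('a \<Rightarrow> real) \<Rightarrow> 'a set \<Rightarrow> 'a \<Rightarrow> bool" where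
  "solution C S x \<longleftrightarrow> x \<in> S \<and> (\<forall>y\<in>S. C x \<le> C y)"

end

theory Submission
  imports Defs
begin

text \<open>
  Minimizing the cost amounts to finding the smallest ball centred in the constraint set that
  contains the union \<open>P\<close> of the targets, because \<open>C x \<le> t \<longleftrightarrow> P \<subseteq> cball x t\<close>. Such a cost is
  1-Lipschitz and coercive, so it attains its minimum on a closed set. If two distinct points
  both had the minimal radius \<open>r\<close>, the parallelogram law would place \<open>P\<close> in a ball of radius
  smaller than \<open>r\<close> around their midpoint, which is feasible by convexity.
\<close>

lemma image_scaleR_cball_0_1:
  fixes x :: "'a::real_normed_vector"
  assumes "t \<ge> 0"
  shows "(\<lambda>f. x + t *\<^sub>R f) ` cball 0 1 = cball x t"
proof -
  have "(\<lambda>f. x + t *\<^sub>R f) ` cball 0 1 = (+) x ` ((*\<^sub>R) t ` cball 0 1)"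
    by (simp add: image_image)
  also have "\<dots> = cball x t"
    \<comment> \<open>At \<open>t = 0\<close> the dilation collapses the ball to a point, which the
      scaling rule for balls does not cover.\<close>
    using assms
    by (cases "t = 0") (simp_all add: cball_scale image_constant_conv flip: cball_translation)
  finally show ?thesis .
qed

text \<open>Boundedness of \<open>Q\<close> provides an admissible radius, so the infimum is not the
  unspecified \<open>Inf {}\<close>. A point of \<open>Q\<close> rules out negative
  \<open>t\<close>, for which \<open>cball x t\<close> is empty.\<close>

lemma max_time_cball_le_iff:
  fixes x :: "'a::real_normed_vector"
  assumes "Q \<noteq> {}" "bounded Q"
  shows "max_time (cball 0 1) x Q \<le> t \<longleftrightarrow> Q \<subseteq> cball x t"
proof -
  define S where "S = {t. t \<ge> 0 \<and> Q \<subseteq> cball x t}"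
  have S: "max_time (cball 0 1) x Q = Inf S"
    unfolding max_time_def S_def
    by (rule arg_cong[where f = Inf]) (auto simp: image_scaleR_cball_0_1 simp del: mem_cball)
  obtain q where q: "q \<in> Q"
    using assms(1) by blast
  have nonneg: "e \<ge> 0" if "q \<in> cball x e" for e
    using that zero_le_dist[of x q] unfolding mem_cball by linarith
  show ?thesis
  proof
    assume *: "max_time (cball 0 1) x Q \<le> t"
    obtain e where e: "Q \<subseteq> cball x e"
      using assms(2) by (auto simp: bounded_any_center[where a = x] subset_iff)
    with q nonneg have "e \<ge> 0"
      by blast
    with e have "S \<noteq> {}"
      unfolding S_def by blast
    \<comment> \<open>Each distance from \<open>x\<close> to a point of \<open>Q\<close> is a lower
      bound of \<open>S\<close>, so the infimum is itself an admissible radius.\<close>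
    then have "dist x q' \<le> Inf S" if "q' \<in> Q" for q'
      using that by (intro cInf_greatest) (auto simp: S_def)
    with * S show "Q \<subseteq> cball x t"
      by fastforce
  next
    assume *: "Q \<subseteq> cball x t"
    with q have "t \<ge> 0"
      using nonneg by blast
    with * have "t \<in> S"
      by (simp add: S_def)
    moreover have "bdd_below S"
      by (auto simp: S_def)
    ultimately show "max_time (cball 0 1) x Q \<le> t"
      unfolding S by (rule cInf_lower)
  qed
qed

text \<open>Valid for all real \<open>t\<close>, this equivalence determines the cost; existence and
  uniqueness below use the cost only through it.\<close>

lemma max_time_cost_cball_le_iff:
  fixes x :: "'a::real_normed_vector"
  assumes "n \<ge> 1" "\<And>i. i \<in> {1..n} \<Longrightarrow> Q i \<noteq> {} \<and> bounded (Q i)"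
  shows "max_time_cost (cball 0 1) n Q x \<le> t \<longleftrightarrow> (\<Union>i\<in>{1..n}. Q i) \<subseteq> cball x t"
proof -
  have "max_time_cost (cball 0 1) n Q x \<le> t \<longleftrightarrow> (\<forall>i\<in>{1..n}. max_time (cball 0 1) x (Q i) \<le> t)"
    unfolding max_time_cost_def using assms(1) by (subst Max_le_iff) auto
  also have "\<dots> \<longleftrightarrow> (\<forall>i\<in>{1..n}. Q i \<subseteq> cball x t)"
    using assms(2) by (intro ball_cong refl max_time_cball_le_iff) auto
  finally show ?thesis
    by (simp add: UN_subset_iff)
qed

text \<open>Apollonius' median formula, i.e. the parallelogram law for \<open>x - p\<close> and
  \<open>y - p\<close>. Its negative term is the strict gain behind uniqueness.\<close>

lemma dist_midpoint_sq:
  fixes x y p :: "'a::real_inner"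
  shows "(dist (midpoint x y) p)\<^sup>2 = ((dist x p)\<^sup>2 + (dist y p)\<^sup>2) / 2 - (dist x y)\<^sup>2 / 4"
proof -
  have "midpoint x y - p = (1/2) *\<^sub>R ((x - p) + (y - p))"
    by (simp add: midpoint_def algebra_simps flip: scaleR_add_left)
  moreover have "x - y = (x - p) - (y - p)"
    by simp
  ultimately show ?thesis
    by (simp only: dist_norm power2_norm_eq_inner inner_add_left inner_add_right inner_diff_left
        inner_diff_right inner_scaleR_left inner_scaleR_right)
      (simp add: inner_commute field_simps)
qed

lemma ex_solution_enclosing_radius:
  fixes P S :: "'a::heine_borel set"
  assumes C: "\<And>x t. C x \<le> t \<longleftrightarrow> P \<subseteq> cball x t"
    and "P \<noteq> {}" "S \<noteq> {}" "closed S"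
  shows "\<exists>x. solution C S x"
proof -
  \<comment> \<open>The case \<open>t = C x\<close> of the equivalence: the enclosing radius is
    attained.\<close>
  have C_self: "P \<subseteq> cball x (C x)" for x
    using C by blast
  have C_lip: "C x \<le> C y + dist x y" for x y
    unfolding C
  proof
    fix p
    assume "p \<in> P"
    with C_self[of y] have "dist y p \<le> C y"
      by auto
    with dist_triangle[of x p y] show "p \<in> cball x (C y + dist x y)"
      by simp
  qed
  have "continuous_on A C" for A
    unfolding continuous_on_iff
  proof (intro ballI allI impI)
    fix x :: 'a and \<epsilon> :: real
    assume "\<epsilon> > 0"
    have "dist (C y) (C x) \<le> dist y x" for y
      using C_lip[of x y] C_lip[of y x] by (simp add: dist_real_def dist_commute)
    with \<open>\<epsilon> > 0\<close> show "\<exists>d>0. \<forall>y\<in>A. dist y x < d \<longrightarrow> dist (C y) (C x) < \<epsilon>"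
      by (meson order_le_less_trans)
  qed
  obtain p x0 where p: "p \<in> P" and x0: "x0 \<in> S"
    using assms by blast
  \<comment> \<open>Since \<open>p\<close> lies in \<open>P\<close>, \<open>C y\<close> is at least
    \<open>dist y p\<close>. Feasible points outside this ball thus cost more than
    \<open>x0\<close>, and a minimum over the compact \<open>K\<close> is global.\<close>
  define K where "K = S \<inter> cball p (C x0)"
  have "compact K"
    unfolding K_def using assms(4) by (simp add: closed_Int_compact)
  moreover have x0K: "x0 \<in> K"
    using C_self[of x0] p x0 by (auto simp: K_def dist_commute)
  ultimately obtain x where x: "x \<in> K" "\<And>y. y \<in> K \<Longrightarrow> C x \<le> C y"
    using continuous_attains_inf[of K C] \<open>continuous_on K C\<close> by blast
  have "C x \<le> C y" if "y \<in> S" for y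
  proof (cases "y \<in> K")
    case False
    with that have "C x0 < dist y p"
      by (auto simp: K_def dist_commute)
    also have "\<dots> \<le> C y"
      using C_self[of y] p by auto
    finally show ?thesis
      using x(2)[OF x0K] by simp
  qed (rule x(2))
  with x(1) show ?thesis
    by (auto simp: solution_def K_def)
qed

lemma solution_enclosing_radius_unique:
  fixes P S :: "'a::real_inner set"
  assumes C: "\<And>x t. C x \<le> t \<longleftrightarrow> P \<subseteq> cball x t"
    and "P \<noteq> {}" "convex S"
    and x: "solution C S x" and y: "solution C S y"
  shows "x = y"
proof (rule ccontr)
  assume "x \<noteq> y"
  define r m where "r = C x" and "m = midpoint x y"
  have r: "C y = r" and xy: "x \<in> S" "y \<in> S"
    using x y by (auto simp: solution_def r_def intro: antisym)
  have "P \<subseteq> cball x r" "P \<subseteq> cball y r"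
    using C[of x r] C[of y r] r by (simp_all add: r_def)
  then have bound: "(dist m p)\<^sup>2 \<le> r\<^sup>2 - (dist x y)\<^sup>2 / 4" if "p \<in> P" for p
    using that power_mono[of "dist x p" r 2] power_mono[of "dist y p" r 2]
    unfolding m_def dist_midpoint_sq by (auto simp: subset_iff)
  \<comment> \<open>The bound does not depend on \<open>p\<close>, so its square root is the radius
    of a ball around \<open>m\<close> containing \<open>P\<close>.\<close>
  then have "C m \<le> sqrt (r\<^sup>2 - (dist x y)\<^sup>2 / 4)"
    unfolding C by (meson mem_cball real_le_rsqrt subsetI)
  also have "\<dots> < r"
  proof (rule real_less_lsqrt)
    \<comment> \<open>Comparing the root with \<open>r\<close> requires \<open>r\<close> to be
      nonnegative, which a point of \<open>P\<close> in \<open>cball x r\<close> guarantees.\<close>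
    obtain p where "p \<in> P"
      using assms(2) by blast
    then show "0 \<le> r"
      using \<open>P \<subseteq> cball x r\<close> by (meson mem_cball order_trans subsetD zero_le_dist)
    show "r\<^sup>2 - (dist x y)\<^sup>2 / 4 < r\<^sup>2"
      using \<open>x \<noteq> y\<close> by simp
  qed
  finally have "C m < r" .
  moreover have "m \<in> S"
    using convexD[OF assms(3) xy, of "1/2" "1/2"] by (simp add: m_def midpoint_def scaleR_add_right)
  ultimately show False
    using x by (auto simp: solution_def r_def not_le[symmetric])
qed

theorem theorem2p6:
  fixes n :: nat
    and Q :: "nat \<Rightarrow> (real ^ 'd) set"
    and \<Omega> :: "(real ^ 'd) set"
  assumes "n \<ge> 1"
    and "\<And>i. i \<in> {1..n} \<Longrightarrow> Q i \<noteq> {} \<and> closed (Q i) \<and> bounded (Q i)"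
    and "\<Omega> \<noteq> {}" and "closed \<Omega>" and "convex \<Omega>"
  shows "\<exists>!x. solution (max_time_cost (cball 0 1) n Q) \<Omega> x"
proof (rule ex_ex1I)
  have C: "max_time_cost (cball 0 1) n Q x \<le> t \<longleftrightarrow> (\<Union>i\<in>{1..n}. Q i) \<subseteq> cball x t" for x t
    using assms(1,2) by (intro max_time_cost_cball_le_iff) auto
  have P: "(\<Union>i\<in>{1..n}. Q i) \<noteq> {}"
    using assms(1,2) by fastforce
  show "\<exists>x. solution (max_time_cost (cball 0 1) n Q) \<Omega> x"
    using C P assms(3,4) by (rule ex_solution_enclosing_radius)
  show "x = y" if "solution (max_time_cost (cball 0 1) n Q) \<Omega> x"
    and "solution (max_time_cost (cball 0 1) n Q) \<Omega> y" for x y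
    using C P assms(5) that by (rule solution_enclosing_radius_unique)
qed

end
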